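(* Let $P$ be an abelian group. Consider operations $$x\cdot y=x\rho+y\lambda$$ and $$(x_1,x_2,x_3)\alpha=x_1a_1+x_2a_2+x_3a_3$$ on the set $P$, with endomorphisms $\rho,\lambda,a_1,a_2,a_3$ of the abelian group $P$. Then $(P,\cdot,\alpha)$ is a semisymmetrized algebra if and only if $\{a_1,a_2,a_3\}$ forms a complete set of orthogonal idempotents, $\rho\lambda=\lambda\rho=1_P=-\rho^3$, and the conjugation relations $a_1=a_2^\rho$, $a_2=a_3^\rho$, $a_3=a_1^\rho$ hold in the endomorphism ring of the abelian group $P$.
   Context: Functions are written to the right of their arguments, so endomorphisms act on the right and a composite $fg$ means first $f$, then $g$: $x(fg)=(xf)g$. For an invertible endomorphism $\rho$, the conjugate is $a^\rho=\rho^{-1}a\rho$. "Complete set of orthogonal idempotents" means $a_1+a_2+a_3=1_P$, $a_i^2=a_i$, and $a_ia_j=0$ for $i\ne j$. A (combinatorial) quasigroup $(P,\cdot)$ is a set with a binary operation, also written by juxtaposition, for which all left multiplications $y\mapsto xy$ and all right multiplications $y\mapsto yx$ are bijections. It is semisymmetric if it satisfies $x\cdot yx=y$ (equivalently $xy\cdot x=y$). A diagonal algebra is an algebra $(P,\alpha)$ with a ternary operation $\alpha$ satisfying the idempotence $(x,x,x)\alpha=x$ and the diagonal identity $$\big((x_{11},x_{12},x_{13})\alpha,(x_{21},x_{22},x_{23})\alpha,(x_{31},x_{32},x_{33})\alpha\big)\alpha=(x_{11},x_{22},x_{33})\alpha .$$ An algebra $(P,\cdot,\alpha)$ with a binary multiplication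 and an idempotent ternary operation $\alpha$ is a semisymmetrized algebra if: (a) $(P,\cdot)$ is a semisymmetric quasigroup; (b) $(P,\alpha)$ is a diagonal algebra; (c) for all $x_i,y_j$ in $P$, the compatibility identity $$(x_1y_1,x_2y_2,x_3y_3)\alpha=(x_3,x_1,x_2)\alpha\cdot(y_2,y_3,y_1)\alpha$$ is satisfied. *)

theory Defs
  imports Complex_Main
begin

text \<open>
  An abelian group \<open>P\<close> is a type of class \<^class>\<open>ab_group_add\<close>, and its endomorphisms are the
  functions satisfying \<^const>\<open>additive\<close>. The endomorphism ring consists of these functions with
  pointwise addition, unit \<^const>\<open>id\<close>, and the diagrammatic product below, since
  endomorphisms act on the right: \<open>x(fg) = (xf)g\<close>.
\<close>

definition end_mult :: "('a \<Rightarrow> 'a) \<Rightarrow> ('a \<Rightarrow> 'a) \<Rightarrow> 'a \<Rightarrow> 'a"  (infixl "\<star>" 70)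
  where "f \<star> g = (\<lambda>x. g (f x))"

text \<open>Meaningful only for bijective \<open>\<rho>\<close>, as \<^const>\<open>inv\<close> is total.\<close>

definition conjugate :: "('a \<Rightarrow> 'a) \<Rightarrow> ('a \<Rightarrow> 'a) \<Rightarrow> 'a \<Rightarrow> 'a"
  where "conjugate a \<rho> = inv \<rho> \<star> a \<star> \<rho>"

definition complete_orthogonal_idempotents ::
    "('a::ab_group_add \<Rightarrow> 'a) \<Rightarrow> ('a \<Rightarrow> 'a) \<Rightarrow> ('a \<Rightarrow> 'a) \<Rightarrow> bool"
  where "complete_orthogonal_idempotents a\<^sub>1 a\<^sub>2 a\<^sub>3 \<longleftrightarrow>
    (\<lambda>x. a\<^sub>1 x + a\<^sub>2 x + a\<^sub>3 x) = id \<and>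
    a\<^sub>1 \<star> a\<^sub>1 = a\<^sub>1 \<and> a\<^sub>2 \<star> a\<^sub>2 = a\<^sub>2 \<and> a\<^sub>3 \<star> a\<^sub>3 = a\<^sub>3 \<and>
    a\<^sub>1 \<star> a\<^sub>2 = (\<lambda>_. 0) \<and> a\<^sub>1 \<star> a\<^sub>3 = (\<lambda>_. 0) \<and>
    a\<^sub>2 \<star> a\<^sub>1 = (\<lambda>_. 0) \<and> a\<^sub>2 \<star> a\<^sub>3 = (\<lambda>_. 0) \<and>
    a\<^sub>3 \<star> a\<^sub>1 = (\<lambda>_. 0) \<and> a\<^sub>3 \<star> a\<^sub>2 = (\<lambda>_. 0)"

definition quasigroup :: "('a \<Rightarrow> 'a \<Rightarrow> 'a) \<Rightarrow> bool"
  where "quasigroup m \<longleftrightarrow> (\<forall>x. bij (\<lambda>y. m x y)) \<and> (\<forall>x. bij (\<lambda>y. m y x))"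

definition semisymmetric_quasigroup :: "('a \<Rightarrow> 'a \<Rightarrow> 'a) \<Rightarrow> bool"
  where "semisymmetric_quasigroup m \<longleftrightarrow> quasigroup m \<and> (\<forall>x y. m x (m y x) = y)"

definition diagonal_algebra :: "('a \<Rightarrow> 'a \<Rightarrow> 'a \<Rightarrow> 'a) \<Rightarrow> bool"
  where "diagonal_algebra \<alpha> \<longleftrightarrow>
    (\<forall>x. \<alpha> x x x = x) \<and>
    (\<forall>x\<^sub>1\<^sub>1 x\<^sub>1\<^sub>2 x\<^sub>1\<^sub>3 x\<^sub>2\<^sub>1 x\<^sub>2\<^sub>2 x\<^sub>2\<^sub>3 x\<^sub>3\<^sub>1 x\<^sub>3\<^sub>2 x\<^sub>3\<^sub>3.
      \<alpha> (\<alpha> x\<^sub>1\<^sub>1 x\<^sub>1\<^sub>2 x\<^sub>1\<^sub>3) (\<alpha> x\<^sub>2\<^sub>1 x\<^sub>2\<^sub>2 x\<^sub>2\<^sub>3) (\<alpha> x\<^sub>3\<^sub>1 x\<^sub>3\<^sub>2 x\<^sub>3\<^sub>3) = \<alpha> x\<^sub>1\<^sub>1 x\<^sub>2\<^sub>2 x\<^sub>3\<^sub>3)"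

definition semisymmetrized_algebra ::
    "('a \<Rightarrow> 'a \<Rightarrow> 'a) \<Rightarrow> ('a \<Rightarrow> 'a \<Rightarrow> 'a \<Rightarrow> 'a) \<Rightarrow> bool"
  where "semisymmetrized_algebra m \<alpha> \<longleftrightarrow>
    semisymmetric_quasigroup m \<and>
    diagonal_algebra \<alpha> \<and>
    (\<forall>x\<^sub>1 x\<^sub>2 x\<^sub>3 y\<^sub>1 y\<^sub>2 y\<^sub>3.
      \<alpha> (m x\<^sub>1 y\<^sub>1) (m x\<^sub>2 y\<^sub>2) (m x\<^sub>3 y\<^sub>3) = m (\<alpha> x\<^sub>3 x\<^sub>1 x\<^sub>2) (\<alpha> y\<^sub>2 y\<^sub>3 y\<^sub>1))"

end

theory Submission imports Defs begin

text \<open>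
  The defining identities are additive in their variables, so each is equivalent to the
  equalities of endomorphisms obtained by setting all variables but one to zero. Semisymmetry
  yields \<open>\<rho>\<lambda> = 1\<close> and \<open>\<rho> = -\<lambda>\<^sup>2\<close>, hence \<open>\<rho>\<^sup>3 = -1\<close>. Compatibility yields \<open>\<rho>a\<^sub>1 = a\<^sub>2\<rho>\<close>,
  \<open>\<rho>a\<^sub>2 = a\<^sub>3\<rho>\<close>, \<open>\<rho>a\<^sub>3 = a\<^sub>1\<rho>\<close> together with three relations in \<open>\<lambda>\<close>, which are equivalent to
  these because \<open>\<lambda> = \<rho>\<^sup>-\<^sup>1\<close>.
\<close>

text \<open>Semisymmetry alone shows that \<open>lam\<close> undoes \<open>\<rho>\<close>; the
  quasigroup axiom makes this inverse two-sided.\<close>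

lemma linear_semisymmetric_quasigroup_iff:
  fixes \<rho> lam :: "'a::ab_group_add \<Rightarrow> 'a"
  assumes "additive \<rho>" and "additive lam"
  shows "semisymmetric_quasigroup (\<lambda>x y. \<rho> x + lam y) \<longleftrightarrow>
    \<rho> \<star> lam = id \<and> lam \<star> \<rho> = id \<and> id = (\<lambda>x. - (\<rho> \<star> \<rho> \<star> \<rho>) x)"
    (is "?L \<longleftrightarrow> ?R")
proof
  assume L: ?L
  have semisym: "\<rho> x + lam (\<rho> y + lam x) = y" for x y
    using L by (simp add: semisymmetric_quasigroup_def)
  have lr: "lam (\<rho> y) = y" for y
    using semisym[of 0 y] by (simp add: additive.zero[OF assms(1)] additive.zero[OF assms(2)])
  have ll: "\<rho> x = - lam (lam x)" for x
    using semisym[of x 0]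
    by (simp add: additive.zero[OF assms(1)] eq_neg_iff_add_eq_0)
  \<comment> \<open>Left multiplication by 0 is \<open>lam\<close>, since
    \<open>\<rho> 0 = 0\<close>.\<close>
  have "bij lam"
    using L additive.zero[OF assms(1)]
    by (auto simp: semisymmetric_quasigroup_def quasigroup_def dest: spec[of _ 0])
  then have rl: "\<rho> (lam y) = y" for y
    by (metis lr bij_is_inj injD)
  have "\<rho> (\<rho> (\<rho> x)) = - x" for x
    by (simp add: ll[of "\<rho> (\<rho> x)"] lr)
  then show ?R
    by (simp add: end_mult_def fun_eq_iff lr rl)
next
  assume R: ?R
  then have lr: "lam (\<rho> x) = x" and rl: "\<rho> (lam x) = x" and r3: "\<rho> (\<rho> (\<rho> x)) = - x" for x
    by (simp_all add: end_mult_def fun_eq_iff) (metis minus_minus)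
  have ll: "lam (lam x) = - \<rho> x" for x
    using r3[of "lam (lam x)"] by (simp add: rl)
  \<comment> \<open>The witnesses here and below solve \<open>\<rho> x + lam y = z\<close> and
    \<open>\<rho> y + lam x = z\<close> for \<open>y\<close>.\<close>
  have "bij (\<lambda>y. \<rho> x + lam y)" for x
    by (rule bij_betw_byWitness[where f' = "\<lambda>z. \<rho> (z - \<rho> x)"]) (auto simp: lr rl)
  moreover have "bij (\<lambda>y. \<rho> y + lam x)" for x
    by (rule bij_betw_byWitness[where f' = "\<lambda>z. lam (z - lam x)"]) (auto simp: lr rl)
  ultimately show ?L
    by (simp add: semisymmetric_quasigroup_def quasigroup_def additive.add[OF assms(2)] lr ll)
qed

text \<open>Idempotence says that the three maps sum to the identity. In the diagonal identity the
  entry in row i, column j passes through the j-th map and then the i-th; it survives on the right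
  only if i = j. The nine entries thus give the nine product relations.\<close>

lemma linear_diagonal_algebra_iff:
  fixes a\<^sub>1 a\<^sub>2 a\<^sub>3 :: "'a::ab_group_add \<Rightarrow> 'a"
  assumes "additive a\<^sub>1" and "additive a\<^sub>2" and "additive a\<^sub>3"
  shows "diagonal_algebra (\<lambda>x\<^sub>1 x\<^sub>2 x\<^sub>3. a\<^sub>1 x\<^sub>1 + a\<^sub>2 x\<^sub>2 + a\<^sub>3 x\<^sub>3) \<longleftrightarrow>
    complete_orthogonal_idempotents a\<^sub>1 a\<^sub>2 a\<^sub>3"
    (is "?L \<longleftrightarrow> ?R")
proof
  note zero = additive.zero[OF assms(1)] additive.zero[OF assms(2)] additive.zero[OF assms(3)]
  assume L: ?L
  have idem: "a\<^sub>1 x + a\<^sub>2 x + a\<^sub>3 x = x" for x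
    using L by (simp add: diagonal_algebra_def)
  have diag: "a\<^sub>1 (a\<^sub>1 x11 + a\<^sub>2 x12 + a\<^sub>3 x13) + a\<^sub>2 (a\<^sub>1 x21 + a\<^sub>2 x22 + a\<^sub>3 x23)
      + a\<^sub>3 (a\<^sub>1 x31 + a\<^sub>2 x32 + a\<^sub>3 x33) = a\<^sub>1 x11 + a\<^sub>2 x22 + a\<^sub>3 x33"
    for x11 x12 x13 x21 x22 x23 x31 x32 x33
    using L unfolding diagonal_algebra_def by blast
  show ?R
    using diag[of _ 0 0 0 0 0 0 0 0] diag[of 0 _ 0 0 0 0 0 0 0] diag[of 0 0 _ 0 0 0 0 0 0]
      diag[of 0 0 0 _ 0 0 0 0 0] diag[of 0 0 0 0 _ 0 0 0 0] diag[of 0 0 0 0 0 _ 0 0 0]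
      diag[of 0 0 0 0 0 0 _ 0 0] diag[of 0 0 0 0 0 0 0 _ 0] diag[of 0 0 0 0 0 0 0 0 _]
    by (simp add: complete_orthogonal_idempotents_def end_mult_def fun_eq_iff idem zero)
next
  assume ?R
  then show ?L
    by (simp add: complete_orthogonal_idempotents_def diagonal_algebra_def end_mult_def fun_eq_iff
        additive.add[OF assms(1)] additive.add[OF assms(2)] additive.add[OF assms(3)])
qed

text \<open>Clears the inverse: for invertible \<open>\<rho>\<close>, the conjugation relation is
  \<open>\<rho> \<star> a = b \<star> \<rho>\<close>, the form in which coefficients appear in
  compatibility.\<close>

lemma eq_conjugate_iff:
  assumes "bij \<rho>"
  shows "a = conjugate b \<rho> \<longleftrightarrow> (\<forall>x. a (\<rho> x) = \<rho> (b x))"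
  by (metis (no_types, lifting) ext assms bij_inv_eq_iff conjugate_def end_mult_def)

lemma linear_compatibility_iff:
  fixes \<rho> lam a\<^sub>1 a\<^sub>2 a\<^sub>3 :: "'a::ab_group_add \<Rightarrow> 'a"
  assumes "additive \<rho>" and "additive lam"
    and "additive a\<^sub>1" and "additive a\<^sub>2" and "additive a\<^sub>3"
    and "\<rho> \<star> lam = id" and "lam \<star> \<rho> = id"
  shows "(\<forall>x\<^sub>1 x\<^sub>2 x\<^sub>3 y\<^sub>1 y\<^sub>2 y\<^sub>3.
      a\<^sub>1 (\<rho> x\<^sub>1 + lam y\<^sub>1) + a\<^sub>2 (\<rho> x\<^sub>2 + lam y\<^sub>2) + a\<^sub>3 (\<rho> x\<^sub>3 + lam y\<^sub>3) =
      \<rho> (a\<^sub>1 x\<^sub>3 + a\<^sub>2 x\<^sub>1 + a\<^sub>3 x\<^sub>2) + lam (a\<^sub>1 y\<^sub>2 + a\<^sub>2 y\<^sub>3 + a\<^sub>3 y\<^sub>1)) \<longleftrightarrow>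
    a\<^sub>1 = conjugate a\<^sub>2 \<rho> \<and> a\<^sub>2 = conjugate a\<^sub>3 \<rho> \<and> a\<^sub>3 = conjugate a\<^sub>1 \<rho>"
    (is "?L \<longleftrightarrow> ?R")
proof -
  have lr: "lam (\<rho> x) = x" and rl: "\<rho> (lam x) = x" for x
    using assms(6,7) by (simp_all add: end_mult_def fun_eq_iff)
  have "bij \<rho>"
    by (rule bij_betw_byWitness[where f' = lam]) (auto simp: lr rl)
  note conj_iff = eq_conjugate_iff[OF this]
  show ?thesis
  proof
    assume L: ?L
    have compat: "a\<^sub>1 (\<rho> x1) + a\<^sub>2 (\<rho> x2) + a\<^sub>3 (\<rho> x3) = \<rho> (a\<^sub>1 x3 + a\<^sub>2 x1 + a\<^sub>3 x2)" for x1 x2 x3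
      using L[rule_format, of x1 0 x2 0 x3 0] by (simp add: assms(1-5)[THEN additive.zero])
    show ?R
      using compat[of _ 0 0] compat[of 0 _ 0] compat[of 0 0 _]
      by (simp add: conj_iff assms(1-5)[THEN additive.zero])
  next
    assume ?R
    then have r: "a\<^sub>1 (\<rho> x) = \<rho> (a\<^sub>2 x)" "a\<^sub>2 (\<rho> x) = \<rho> (a\<^sub>3 x)" "a\<^sub>3 (\<rho> x) = \<rho> (a\<^sub>1 x)" for x
      by (simp_all add: conj_iff)
    \<comment> \<open>The coefficients of the \<open>y\<close> variables: evaluate each relation in
      \<open>r\<close> at \<open>lam x\<close> and apply \<open>lam\<close> to both sides.\<close>
    have "a\<^sub>1 (lam x) = lam (a\<^sub>3 x)" "a\<^sub>2 (lam x) = lam (a\<^sub>1 x)" "a\<^sub>3 (lam x) = lam (a\<^sub>2 x)" for x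
      by (metis r lr rl)+
    with r show ?L
      by (simp add: assms(1-5)[THEN additive.add] ac_simps)
  qed
qed

theorem theorem6p3:
  fixes \<rho> lam a\<^sub>1 a\<^sub>2 a\<^sub>3 :: "'a::ab_group_add \<Rightarrow> 'a"
  assumes "additive \<rho>" and "additive lam"
    and "additive a\<^sub>1" and "additive a\<^sub>2" and "additive a\<^sub>3"
  shows "semisymmetrized_algebra
           (\<lambda>x y. \<rho> x + lam y)
           (\<lambda>x\<^sub>1 x\<^sub>2 x\<^sub>3. a\<^sub>1 x\<^sub>1 + a\<^sub>2 x\<^sub>2 + a\<^sub>3 x\<^sub>3)
         \<longleftrightarrow>
         complete_orthogonal_idempotents a\<^sub>1 a\<^sub>2 a\<^sub>3 \<and>
         (\<rho> \<star> lam = id \<and> lam \<star> \<rho> = id \<and> id = (\<lambda>x. - (\<rho> \<star> \<rho> \<star> \<rho>) x)) \<and>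
         (a\<^sub>1 = conjugate a\<^sub>2 \<rho> \<and> a\<^sub>2 = conjugate a\<^sub>3 \<rho> \<and> a\<^sub>3 = conjugate a\<^sub>1 \<rho>)"
  unfolding semisymmetrized_algebra_def linear_semisymmetric_quasigroup_iff[OF assms(1,2)]
    linear_diagonal_algebra_iff[OF assms(3-5)]
  \<comment> \<open>The two premises left open, that \<open>\<rho>\<close> and \<open>lam\<close>
    are mutually inverse, come from the semisymmetry conjunct, present on both sides.\<close>
  using linear_compatibility_iff[OF assms] by blast

end
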